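(* Let $G$ be a finite group and let $N\trianglelefteq G$ be a normal subgroup. Then $\mathrm{dc}^k(G)\le\mathrm{dc}^k(N)\,\mathrm{dc}^k(G/N)$ for all $k\in\mathbb{N}$.
   Context: Simple commutators are defined by $[x_1,x_2]=x_1^{-1}x_2^{-1}x_1x_2$ and $[x_1,\ldots,x_k]=[[x_1,\ldots,x_{k-1}],x_k]$. For a finite group $Q$, $\mathrm{dc}^k(Q)$ is the probability that $[x_1,\ldots,x_{k+1}]=1$ when $x_1,\ldots,x_{k+1}$ are chosen independently and uniformly at random from $Q$, i.e. $\mathrm{dc}^k(Q)=|\{(x_1,\ldots,x_{k+1})\in Q^{k+1}:[x_1,\ldots,x_{k+1}]=1\}|/|Q|^{k+1}$. *)

theory Defs
  imports Complex_Main "HOL-Algebra.Coset"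
begin

(* HOL-Algebra's derived_set uses x y x^-1 y^-1; here the convention is x^-1 y^-1 x y. *)
definition group_commutator :: "('a, 'b) monoid_scheme \<Rightarrow> 'a \<Rightarrow> 'a \<Rightarrow> 'a" where
  "group_commutator G x y =
     inv\<^bsub>G\<^esub> x \<otimes>\<^bsub>G\<^esub> inv\<^bsub>G\<^esub> y \<otimes>\<^bsub>G\<^esub> x \<otimes>\<^bsub>G\<^esub> y"

(* Left-normed, with the usual convention [x] = x; the value on the empty list is a dummy. *)
primrec simple_commutator :: "('a, 'b) monoid_scheme \<Rightarrow> 'a list \<Rightarrow> 'a" where
  "simple_commutator G [] = \<one>\<^bsub>G\<^esub>"
| "simple_commutator G (x # xs) = foldl (group_commutator G) x xs"

lemma simple_commutator_pair:
  "simple_commutator G [x, y] = group_commutator G x y"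
  by simp

lemma simple_commutator_snoc:
  "xs \<noteq> [] \<Longrightarrow>
     simple_commutator G (xs @ [y]) = group_commutator G (simple_commutator G xs) y"
  by (cases xs) simp_all

(* Elements of Q^(k+1) are represented as lists of length k+1. *)
definition dc :: "nat \<Rightarrow> ('a, 'b) monoid_scheme \<Rightarrow> real" where
  "dc k Q =
     real (card {xs. length xs = k + 1 \<and> set xs \<subseteq> carrier Q \<and>
                     simple_commutator Q xs = \<one>\<^bsub>Q\<^esub>})
     / real (order Q) ^ (k + 1)"

end

theory Submission
  imports Defs
begin

text \<open>
  If \<open>\<phi>\<close> is a positive definite class function on \<open>G\<close>, then its sum over any coset of \<open>N\<close> is at most
  its sum over \<open>N\<close>. For each fixed \<open>c\<close> the function \<open>z \<mapsto> \<phi> [c, z]\<close> is again positive definite, because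
  \<open>\<phi> [c, y x\<inverse>] = \<phi> (c\<^sup>y (c\<^sup>x)\<inverse>)\<close>, where \<open>c\<^sup>x = x\<inverse> c x\<close>; and since \<open>[d, n]\<inverse> = [n, d]\<close>, the function
  \<open>d \<mapsto> \<Sum>n\<in>N. \<phi> [d, n]\<close> is a positive definite class function as well. Starting from the indicator
  function of the identity, one may therefore replace the cosets in a tuple by \<open>N\<close> one entry at a
  time, from the last to the first, without decreasing the number of tuples of representatives with
  trivial simple commutator. It remains to sum over all tuples of cosets whose commutator is trivial.
\<close>

section \<open>Counting tuples in a product of finite sets\<close>

lemma finite_list_all2_mem:
  "(\<And>C. C \<in> set Cs \<Longrightarrow> finite C) \<Longrightarrow> finite {xs. list_all2 (\<in>) xs Cs}"
proof (induction Cs)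
  case (Cons C Cs)
  have "{xs. list_all2 (\<in>) xs (C # Cs)} = (\<lambda>(x, xs). x # xs) ` (C \<times> {xs. list_all2 (\<in>) xs Cs})"
    by (auto simp: list_all2_Cons2)
  then show ?case
    using Cons by simp
qed simp

text \<open>\<open>list_all2 (\<in>) xs Cs\<close> makes \<open>xs\<close> a point of the Cartesian
  product of the sets in \<open>Cs\<close>; the tuples are fibred over their first entry.\<close>

lemma card_list_all2_Cons:
  fixes C :: "'a set"
  assumes "finite C" "\<And>D. D \<in> set Cs \<Longrightarrow> finite D"
  shows "card {xs. list_all2 (\<in>) xs (C # Cs) \<and> P xs}
       = (\<Sum>x\<in>C. card {xs. list_all2 (\<in>) xs Cs \<and> P (x # xs)})"
proof -
  have "{xs. list_all2 (\<in>) xs (C # Cs) \<and> P xs}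
      = (\<lambda>(x, xs). x # xs) ` (SIGMA x:C. {xs. list_all2 (\<in>) xs Cs \<and> P (x # xs)})"
    by (auto simp: list_all2_Cons2)
  moreover have "inj_on (\<lambda>(x, xs). x # xs) A" for A :: "('a \<times> 'a list) set"
    by (auto simp: inj_on_def)
  moreover have "finite {xs. list_all2 (\<in>) xs Cs \<and> P (x # xs)}" for x
    using finite_list_all2_mem[of Cs] assms(2) by (rule_tac finite_subset) auto
  ultimately show ?thesis
    using assms(1) by (simp only: card_image card_SigmaI) simp
qed

section \<open>Positive definite functions and class functions on a finite group\<close>

context group
begin

lemma inv_mult_cancel:
  assumes "x \<in> carrier G" "y \<in> carrier G"
  shows "inv x \<otimes> (x \<otimes> y) = y" and "x \<otimes> (inv x \<otimes> y) = y"
  using assms by (simp_all flip: m_assoc)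

lemmas word_simps = m_assoc inv_mult_group inv_mult_cancel

text \<open>Real coefficients \<open>a\<close> detect only the symmetric part of the matrix with
  entries \<open>\<phi> (y \<otimes> inv x)\<close>, so symmetry is a separate conjunct.\<close>

definition pos_def :: "('a \<Rightarrow> real) \<Rightarrow> bool" where
  "pos_def \<phi> \<longleftrightarrow> (\<forall>x\<in>carrier G. \<phi> (inv x) = \<phi> x) \<and>
     (\<forall>a. 0 \<le> (\<Sum>x\<in>carrier G. \<Sum>y\<in>carrier G. a x * a y * \<phi> (y \<otimes> inv x)))"

text \<open>Equivalent to constancy on conjugacy classes; in this form it rotates a product
  cyclically.\<close>

definition class_fun :: "('a \<Rightarrow> real) \<Rightarrow> bool" where
  "class_fun \<phi> \<longleftrightarrow> (\<forall>x\<in>carrier G. \<forall>y\<in>carrier G. \<phi> (x \<otimes> y) = \<phi> (y \<otimes> x))"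

lemma group_commutator_closed [simp]:
  "x \<in> carrier G \<Longrightarrow> y \<in> carrier G \<Longrightarrow> group_commutator G x y \<in> carrier G"
  by (simp add: group_commutator_def)

lemma pos_def_sum:
  assumes "\<And>i. i \<in> I \<Longrightarrow> pos_def (f i)"
  shows "pos_def (\<lambda>x. \<Sum>i\<in>I. f i x)"
proof -
  have "0 \<le> (\<Sum>x\<in>carrier G. \<Sum>y\<in>carrier G. a x * a y * (\<Sum>i\<in>I. f i (y \<otimes> inv x)))" for a
  proof -
    have "(\<Sum>x\<in>carrier G. \<Sum>y\<in>carrier G. a x * a y * (\<Sum>i\<in>I. f i (y \<otimes> inv x)))
        = (\<Sum>i\<in>I. \<Sum>x\<in>carrier G. \<Sum>y\<in>carrier G. a x * a y * f i (y \<otimes> inv x))"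
      by (simp only: sum_distrib_left sum.swap[where B = I])
    also have "\<dots> \<ge> 0"
      using assms unfolding pos_def_def by (intro sum_nonneg[of I]) blast
    finally show ?thesis .
  qed
  then show ?thesis
    using assms by (simp add: pos_def_def)
qed

text \<open>Pushing the coefficients \<open>a\<close> forward along \<open>u\<close> turns this sum
  into the quadratic form of \<open>\<phi>\<close> itself. The map \<open>u\<close> is arbitrary; it
  will be \<open>x \<mapsto> inv x \<otimes> c \<otimes> x\<close>, which is not a homomorphism in
  general.\<close>

lemma pos_def_comp:
  assumes fin: "finite (carrier G)" and \<phi>: "pos_def \<phi>"
    and u: "\<And>x. x \<in> carrier G \<Longrightarrow> u x \<in> carrier G"
  shows "0 \<le> (\<Sum>x\<in>carrier G. \<Sum>y\<in>carrier G. a x * a y * \<phi> (u y \<otimes> inv (u x)))"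
proof -
  define b where "b p = (\<Sum>x | x \<in> carrier G \<and> u x = p. a x)" for p
  have push: "(\<Sum>p\<in>carrier G. b p * f p) = (\<Sum>x\<in>carrier G. a x * f (u x))" for f
  proof -
    have "(\<Sum>p\<in>carrier G. b p * f p)
        = (\<Sum>p\<in>carrier G. \<Sum>x | x \<in> carrier G \<and> u x = p. a x * f (u x))"
      by (simp add: b_def sum_distrib_right)
    also have "\<dots> = (\<Sum>x\<in>carrier G. a x * f (u x))"
      using fin u by (intro sum.group) auto
    finally show ?thesis .
  qed
  have "(\<Sum>x\<in>carrier G. \<Sum>y\<in>carrier G. a x * a y * \<phi> (u y \<otimes> inv (u x)))
      = (\<Sum>x\<in>carrier G. a x * (\<Sum>y\<in>carrier G. a y * \<phi> (u y \<otimes> inv (u x))))"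
    by (simp add: sum_distrib_left mult.assoc)
  also have "\<dots> = (\<Sum>p\<in>carrier G. b p * (\<Sum>q\<in>carrier G. b q * \<phi> (q \<otimes> inv p)))"
    by (simp add: push)
  also have "\<dots> = (\<Sum>p\<in>carrier G. \<Sum>q\<in>carrier G. b p * b q * \<phi> (q \<otimes> inv p))"
    by (simp add: sum_distrib_left mult.assoc)
  also have "\<dots> \<ge> 0"
    using \<phi> by (simp add: pos_def_def)
  finally show ?thesis .
qed

lemma group_commutator_inv:
  assumes "x \<in> carrier G" "y \<in> carrier G"
  shows "inv (group_commutator G x y) = group_commutator G y x"
  using assms by (simp add: group_commutator_def word_simps)

lemma pos_def_commutator:
  assumes fin: "finite (carrier G)" and \<phi>: "pos_def \<phi>" "class_fun \<phi>"
    and c: "c \<in> carrier G"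
  shows "pos_def (\<lambda>z. \<phi> (group_commutator G c z))"
  unfolding pos_def_def
proof (intro conjI ballI allI)
  fix z assume z: "z \<in> carrier G"
  have "\<phi> (group_commutator G c (inv z)) = \<phi> (inv (group_commutator G c (inv z)))"
    using \<phi> c z by (simp add: pos_def_def)
  \<comment> \<open>The inverse of [c, z^-1] is z c^-1 z^-1 c, a cyclic rotation of [c, z].\<close>
  also have "\<dots> = \<phi> (z \<otimes> (inv c \<otimes> inv z \<otimes> c))"
    using c z by (simp add: group_commutator_def word_simps)
  also have "\<dots> = \<phi> ((inv c \<otimes> inv z \<otimes> c) \<otimes> z)"
    using \<phi> c z by (simp only: class_fun_def) simp
  finally show "\<phi> (group_commutator G c (inv z)) = \<phi> (group_commutator G c z)"
    by (simp add: group_commutator_def)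
next
  fix a
  define u where "u x = inv x \<otimes> c \<otimes> x" for x
  have u: "x \<in> carrier G \<Longrightarrow> u x \<in> carrier G" for x
    using c by (simp add: u_def)
  have "\<phi> (group_commutator G c (y \<otimes> inv x)) = \<phi> (u y \<otimes> inv (u x))"
    if "x \<in> carrier G" "y \<in> carrier G" for x y
  proof -
    \<comment> \<open>The word is split after c^-1 x because rotating this prefix to the end
      completes the inverse of \<open>u x\<close>.\<close>
    have "\<phi> (group_commutator G c (y \<otimes> inv x)) = \<phi> ((inv c \<otimes> x) \<otimes> (inv y \<otimes> c \<otimes> y \<otimes> inv x))"
      using that c by (simp add: group_commutator_def word_simps)
    also have "\<dots> = \<phi> ((inv y \<otimes> c \<otimes> y \<otimes> inv x) \<otimes> (inv c \<otimes> x))"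
      using \<phi> that c by (simp only: class_fun_def) simp
    also have "\<dots> = \<phi> (u y \<otimes> inv (u x))"
      using that c by (simp add: u_def word_simps)
    finally show ?thesis .
  qed
  then show "0 \<le> (\<Sum>x\<in>carrier G. \<Sum>y\<in>carrier G.
                    a x * a y * \<phi> (group_commutator G c (y \<otimes> inv x)))"
    using pos_def_comp[OF fin \<phi>(1) u] by simp
qed

lemma mult_eq_one_commute:
  assumes "x \<in> carrier G" "y \<in> carrier G"
  shows "x \<otimes> y = \<one> \<longleftrightarrow> y \<otimes> x = \<one>"
  using assms inv_comm by blast

text \<open>The quadratic form collapses to its diagonal, a sum of squares. This starts the
  induction over the length of the tuple.\<close>

lemma delta_one:
  assumes "finite (carrier G)"
  shows "pos_def (\<lambda>x. of_bool (x = \<one>))" and "class_fun (\<lambda>x. of_bool (x = \<one>))"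
proof -
  have eq: "y \<otimes> inv x = \<one> \<longleftrightarrow> y = x" if "x \<in> carrier G" "y \<in> carrier G" for x y
    using that by (metis inv_closed inv_equality inv_inv r_inv)
  have "(\<Sum>x\<in>carrier G. \<Sum>y\<in>carrier G. a x * a y * of_bool (y \<otimes> inv x = \<one>))
      = (\<Sum>x\<in>carrier G. a x * a x)" for a :: "'a \<Rightarrow> real"
    using assms by (intro sum.cong refl) (simp add: eq if_distrib of_bool_def cong: if_cong)
  then show "pos_def (\<lambda>x. of_bool (x = \<one>))"
    by (simp add: pos_def_def sum_nonneg)
  show "class_fun (\<lambda>x. of_bool (x = \<one>))"
    using mult_eq_one_commute by (simp add: class_fun_def)
qed

end

section \<open>Sums over a normal subgroup and its cosets\<close>

context normal
begin

text \<open>\<open>pos_def_commutator\<close> concerns the second slot, whereas here the variable is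
  in the first; inverting the commutator swaps the slots, and symmetry of \<open>\<phi>\<close>
  absorbs the inverse. The class property holds because conjugation permutes
  \<open>H\<close>.\<close>

lemma sum_commutator:
  assumes fin: "finite (carrier G)" and \<phi>: "pos_def \<phi>" "class_fun \<phi>"
  shows "pos_def (\<lambda>d. \<Sum>n\<in>H. \<phi> (group_commutator G d n))" (is "pos_def ?\<psi>")
    and "class_fun (\<lambda>d. \<Sum>n\<in>H. \<phi> (group_commutator G d n))"
proof -
  have *: "?\<psi> d = (\<Sum>n\<in>H. \<phi> (group_commutator G n d))" if "d \<in> carrier G" for d
  proof (intro sum.cong refl)
    fix n assume "n \<in> H"
    then have n: "n \<in> carrier G"
      by simp
    then have "\<phi> (inv (group_commutator G n d)) = \<phi> (group_commutator G n d)"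
      using \<phi>(1) that by (simp add: pos_def_def)
    then show "\<phi> (group_commutator G d n) = \<phi> (group_commutator G n d)"
      using n that by (simp add: group_commutator_inv)
  qed
  have "pos_def (\<lambda>d. \<Sum>n\<in>H. \<phi> (group_commutator G n d))"
    using fin \<phi> by (intro pos_def_sum pos_def_commutator) auto
  then show "pos_def ?\<psi>"
    by (simp add: pos_def_def *)
  have conj: "?\<psi> (x \<otimes> y) = ?\<psi> (y \<otimes> x)" if xy: "x \<in> carrier G" "y \<in> carrier G" for x y
  proof -
    \<comment> \<open>Since xy = x(yx)x^-1, the commutator on the left is the conjugate x [yx, n]
      x^-1.\<close>
    have "\<phi> (group_commutator G (x \<otimes> y) (x \<otimes> n \<otimes> inv x)) = \<phi> (group_commutator G (y \<otimes> x) n)"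
      if n: "n \<in> H" for n
    proof -
      have n': "n \<in> carrier G"
        using n by simp
      have "\<phi> (group_commutator G (x \<otimes> y) (x \<otimes> n \<otimes> inv x))
          = \<phi> (x \<otimes> (group_commutator G (y \<otimes> x) n \<otimes> inv x))"
        using xy n' by (simp add: group_commutator_def word_simps)
      also have "\<dots> = \<phi> ((group_commutator G (y \<otimes> x) n \<otimes> inv x) \<otimes> x)"
        using \<phi>(2) xy n' by (simp only: class_fun_def) simp
      finally show ?thesis
        using xy n' by (simp add: word_simps)
    qed
    moreover have "bij_betw (\<lambda>n. x \<otimes> n \<otimes> inv x) H H"
    proof (rule bij_betwI[where g = "\<lambda>n. inv x \<otimes> n \<otimes> x"])
      show "(\<lambda>n. x \<otimes> n \<otimes> inv x) \<in> H \<rightarrow> H" "(\<lambda>n. inv x \<otimes> n \<otimes> x) \<in> H \<rightarrow> H"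
        using xy inv_op_closed1 inv_op_closed2 by auto
    qed (use xy in \<open>simp_all add: word_simps\<close>)
    ultimately show ?thesis
      by (subst sum.reindex_bij_betw[symmetric, of "\<lambda>n. x \<otimes> n \<otimes> inv x" H H]) auto
  qed
  then show "class_fun ?\<psi>"
    by (simp add: class_fun_def)
qed

text \<open>Expand the quadratic form of \<^term>\<open>\<phi>\<close> at the difference of the indicator functions of \<^term>\<open>H\<close> and \<^term>\<open>C\<close>.\<close>
lemma sum_coset_le:
  assumes fin: "finite (carrier G)" and \<phi>: "pos_def \<phi>" and C: "C \<in> rcosets H"
  shows "(\<Sum>x\<in>C. \<phi> x) \<le> (\<Sum>x\<in>H. \<phi> x)"
proof -
  obtain g where g: "g \<in> carrier G" "C = H #> g"
    using C by (auto simp: RCOSETS_def)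
  have CG: "C \<subseteq> carrier G" and HG: "H \<subseteq> carrier G"
    using g r_coset_subset_G subset by auto
  have finH: "finite H"
    using finite_subset[OF HG fin] .
  have cardC: "card C = card H"
    using card_rcosets_equal[OF C] HG by simp
  \<comment> \<open>Normality enters here: as a left coset, \<open>C\<close> is stable under right
    multiplication by \<open>H\<close>, which evaluates the mixed term \<open>Q H C\<close>.\<close>
  have gH: "C = g <# H"
    using g coset_eq by simp
  have shift: "(\<Sum>y\<in>A. \<phi> (y \<otimes> inv x)) = (\<Sum>z\<in>B. \<phi> z)"
    if "A #> inv x = B" "A \<subseteq> carrier G" "x \<in> carrier G" for x A B
  proof -
    have "B = (\<lambda>y. y \<otimes> inv x) ` A"
      using that by (auto simp: r_coset_def)
    moreover have "inj_on (\<lambda>y. y \<otimes> inv x) A"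
      using that by (intro inj_onI) (metis inv_closed right_cancel subsetD)
    ultimately show ?thesis
      by (simp add: sum.reindex)
  qed
  define Q where "Q A B = (\<Sum>x\<in>A. \<Sum>y\<in>B. \<phi> (y \<otimes> inv x))" for A B
  have HH: "Q H H = card H * (\<Sum>x\<in>H. \<phi> x)"
  proof -
    have "H #> inv x = H" if "x \<in> H" for x
      using that by (simp add: rcos_const is_group)
    then show ?thesis
      by (simp add: Q_def shift HG)
  qed
  have HC: "Q H C = card H * (\<Sum>x\<in>C. \<phi> x)"
  proof -
    have "C #> inv x = C" if "x \<in> H" for x
    proof -
      have "C #> inv x = g <# (H #> inv x)"
        using that g HG by (simp only: gH coset_assoc inv_closed mem_carrier)
      also have "H #> inv x = H"
        using that by (simp add: rcos_const is_group)
      finally show ?thesis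
        by (simp add: gH)
    qed
    then show ?thesis
      by (simp add: Q_def shift CG)
  qed
  have CC: "Q C C = card H * (\<Sum>x\<in>H. \<phi> x)"
  proof -
    have "C #> inv x = H" if x: "x \<in> C" for x
    proof -
      have "C = H #> x"
        using x g repr_independence subgroup_axioms by simp
      then show ?thesis
        using x CG HG coset_mult_assoc[of H x "inv x"] by auto
    qed
    then show ?thesis
      using CG by (simp add: Q_def shift subset_iff cardC)
  qed
  have CH: "Q C H = Q H C"
  proof -
    have "\<phi> (y \<otimes> inv x) = \<phi> (x \<otimes> inv y)" if "x \<in> C" "y \<in> H" for x y
    proof -
      have *: "x \<in> carrier G" "y \<in> carrier G"
        using that CG by auto
      then have "\<phi> (inv (x \<otimes> inv y)) = \<phi> (x \<otimes> inv y)"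
        using \<phi> by (simp add: pos_def_def)
      then show ?thesis
        using * by (simp add: inv_mult_group)
    qed
    then show ?thesis
      unfolding Q_def by (subst sum.swap) simp
  qed
  define a :: "'a \<Rightarrow> real" where "a x = of_bool (x \<in> H) - of_bool (x \<in> C)" for x
  have ind: "(\<Sum>x\<in>carrier G. a x * f x) = (\<Sum>x\<in>H. f x) - (\<Sum>x\<in>C. f x)" for f
  proof -
    have "(\<Sum>x\<in>carrier G. of_bool (x \<in> A) * f x) = (\<Sum>x\<in>A. f x)" if "A \<subseteq> carrier G" for A
      using fin that by (intro sum.mono_neutral_cong_right) auto
    then show ?thesis
      using CG HG by (simp add: a_def left_diff_distrib sum_subtractf)
  qed
  have "0 \<le> (\<Sum>x\<in>carrier G. \<Sum>y\<in>carrier G. a x * a y * \<phi> (y \<otimes> inv x))"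
    using \<phi> by (simp add: pos_def_def)
  also have "\<dots> = (\<Sum>x\<in>carrier G. a x * (\<Sum>y\<in>carrier G. a y * \<phi> (y \<otimes> inv x)))"
    by (simp add: sum_distrib_left mult.assoc)
  also have "\<dots> = Q H H - Q H C - (Q C H - Q C C)"
    by (simp add: ind Q_def sum_subtractf)
  also have "\<dots> = 2 * (card H * ((\<Sum>x\<in>H. \<phi> x) - (\<Sum>x\<in>C. \<phi> x)))"
    by (simp add: HH HC CH CC algebra_simps)
  finally have "0 \<le> card H * ((\<Sum>x\<in>H. \<phi> x) - (\<Sum>x\<in>C. \<phi> x))"
    by simp
  moreover have "card H > 0"
    using finH subgroup.one_closed[OF subgroup_axioms] by (metis card_gt_0_iff empty_iff)
  ultimately show ?thesis
    by (simp add: zero_le_mult_iff)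
qed

section \<open>Replacing cosets by the normal subgroup\<close>

text \<open>Here \<open>d\<close> is the value of the commutator built so far, and \<open>Cs\<close>
  lists the cosets of the entries still to come. Values are real so that \<open>pos_def\<close>
  applies.\<close>

definition solutions :: "'a set list \<Rightarrow> 'a \<Rightarrow> real" where
  "solutions Cs d =
     card {xs. list_all2 (\<in>) xs Cs \<and> foldl (group_commutator G) d xs = \<one>}"

lemma solutions_Cons:
  assumes "finite C" "\<And>D. D \<in> set Cs \<Longrightarrow> finite D"
  shows "solutions (C # Cs) d = (\<Sum>x\<in>C. solutions Cs (group_commutator G d x))"
  using assms by (simp add: solutions_def card_list_all2_Cons)

lemma solutions_Nil: "solutions [] = (\<lambda>d. of_bool (d = \<one>))"
  by (simp add: solutions_def fun_eq_iff Collect_conv_if)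

text \<open>By \<open>solutions_Cons\<close>, prepending a copy of \<open>H\<close> is exactly the
  operation of \<open>sum_commutator\<close>.\<close>

lemma solutions_replicate:
  assumes fin: "finite (carrier G)"
  shows "pos_def (solutions (replicate l H)) \<and> class_fun (solutions (replicate l H))"
proof (induction l)
  case 0
  then show ?case
    using delta_one[OF fin] by (simp add: solutions_Nil)
next
  case (Suc l)
  have "finite H"
    using fin finite_subset subset by blast
  then have "solutions (replicate (Suc l) H)
      = (\<lambda>d. \<Sum>n\<in>H. solutions (replicate l H) (group_commutator G d n))"
    using solutions_Cons[of H "replicate l H"] by (auto simp: fun_eq_iff)
  then show ?case
    using sum_commutator[OF fin, of "solutions (replicate l H)"] Suc by (simp only: simp_thms)
qed

text \<open>The tail is replaced before the head: once it consists of copies of \<open>H\<close>,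
  its count is a positive definite class function by \<open>solutions_replicate\<close>, so
  \<open>pos_def_commutator\<close> and \<open>sum_coset_le\<close> handle the head. The induction
  needs arbitrary \<open>d\<close>, since the tail starts from [d, x].\<close>

lemma solutions_le:
  assumes fin: "finite (carrier G)" and "set Cs \<subseteq> rcosets H" and "d \<in> carrier G"
  shows "solutions Cs d \<le> solutions (replicate (length Cs) H) d"
  using assms(2,3)
proof (induction Cs arbitrary: d)
  case (Cons C Cs)
  let ?\<phi> = "solutions (replicate (length Cs) H)"
  have sub: "D \<subseteq> carrier G" if "D \<in> set (C # Cs)" for D
    using that Cons.prems(1) rcosets_part_G[OF subgroup_axioms] by auto
  have finD: "finite D" if "D \<in> set (C # Cs)" for D
    using sub[OF that] fin finite_subset by blast
  have finH: "finite H"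
    using fin finite_subset subset by blast
  have "solutions (C # Cs) d = (\<Sum>x\<in>C. solutions Cs (group_commutator G d x))"
    using finD by (intro solutions_Cons) auto
  also have "\<dots> \<le> (\<Sum>x\<in>C. ?\<phi> (group_commutator G d x))"
  proof (intro sum_mono Cons.IH)
    fix x assume "x \<in> C"
    then have "x \<in> carrier G"
      using sub[of C] by auto
    then show "group_commutator G d x \<in> carrier G"
      using Cons.prems(2) by simp
  qed (use Cons.prems(1) in simp)
  also have "\<dots> \<le> (\<Sum>x\<in>H. ?\<phi> (group_commutator G d x))"
    using Cons.prems solutions_replicate[OF fin]
    by (intro sum_coset_le fin pos_def_commutator) auto
  also have "\<dots> = solutions (replicate (length (C # Cs)) H) d"
    using finH solutions_Cons[of H "replicate (length Cs) H" d] by auto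
  finally show ?case .
qed simp

text \<open>The first entry is the starting value of the fold, not a second argument of a
  commutator, so its coset is replaced by applying \<open>sum_coset_le\<close> directly to
  \<open>solutions\<close>.\<close>

lemma card_simple_commutator_le:
  assumes fin: "finite (carrier G)" and Cs: "set Cs \<subseteq> rcosets H" "length Cs = k + 1"
  shows "card {xs. list_all2 (\<in>) xs Cs \<and> simple_commutator G xs = \<one>}
       \<le> card {xs. length xs = k + 1 \<and> set xs \<subseteq> H \<and> simple_commutator G xs = \<one>}"
proof -
  obtain D Ds where D: "Cs = D # Ds" "length Ds = k"
    using Cs(2) by (cases Cs) auto
  have sub: "E \<subseteq> carrier G" if "E \<in> set Cs" for E
    using that Cs(1) rcosets_part_G[OF subgroup_axioms] by auto
  have finE: "finite E" if "E \<in> set Cs" for E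
    using sub[OF that] fin finite_subset by blast
  have finH: "finite H"
    using fin finite_subset subset by blast
  have eq: "{xs. length xs = k + 1 \<and> set xs \<subseteq> H \<and> simple_commutator G xs = \<one>}
      = {xs. list_all2 (\<in>) xs (H # replicate k H) \<and> simple_commutator G xs = \<one>}"
    by (auto simp: list_all2_conv_all_nth set_conv_nth nth_Cons' simp flip: replicate_Suc)
  have "real (card {xs. list_all2 (\<in>) xs Cs \<and> simple_commutator G xs = \<one>})
      = (\<Sum>x\<in>D. solutions Ds x)"
    using finE D by (simp add: card_list_all2_Cons solutions_def)
  also have "\<dots> \<le> (\<Sum>x\<in>D. solutions (replicate k H) x)"
    using D Cs sub solutions_le[OF fin, of Ds] by (intro sum_mono) auto
  also have "\<dots> \<le> (\<Sum>x\<in>H. solutions (replicate k H) x)"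
    using D Cs solutions_replicate[OF fin] by (intro sum_coset_le fin) auto
  also have "\<dots> = card {xs. length xs = k + 1 \<and> set xs \<subseteq> H \<and> simple_commutator G xs = \<one>}"
    unfolding eq using finH by (subst card_list_all2_Cons) (simp_all add: solutions_def)
  finally show ?thesis
    by simp
qed

section \<open>Commutators in the quotient and in the subgroup\<close>

lemma simple_commutator_FactGroup:
  assumes "set xs \<subseteq> carrier G"
  shows "simple_commutator (G Mod H) (map ((#>) H) xs) = H #> simple_commutator G xs"
proof -
  have *: "group_commutator (G Mod H) (H #> x) (H #> y) = H #> group_commutator G x y"
    if "x \<in> carrier G" "y \<in> carrier G" for x y
  proof -
    have "inv\<^bsub>G Mod H\<^esub> (H #> z) = H #> inv z" if "z \<in> carrier G" for z
      using that by (subst inv_FactGroup) (auto simp: carrier_FactGroup rcos_inv)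
    then show ?thesis
      using that by (simp add: group_commutator_def rcos_sum)
  qed
  have fold: "foldl (group_commutator (G Mod H)) (H #> d) (map ((#>) H) ys)
      = H #> foldl (group_commutator G) d ys"
    if "d \<in> carrier G" "set ys \<subseteq> carrier G" for d ys
    using that by (induction ys arbitrary: d) (simp_all add: *)
  show ?thesis
    using assms by (cases xs) (simp_all add: fold coset_mult_one subset)
qed

lemma simple_commutator_subgroup:
  assumes "set xs \<subseteq> H"
  shows "simple_commutator (G\<lparr>carrier := H\<rparr>) xs = simple_commutator G xs"
proof -
  have *: "group_commutator (G\<lparr>carrier := H\<rparr>) x y = group_commutator G x y"
    if "x \<in> H" "y \<in> H" for x y
    using that m_inv_consistent[OF subgroup_axioms] by (simp add: group_commutator_def)
  \<comment> \<open>The identity for single commutators is available only on \<open>H\<close>, so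
    the running value of the fold must stay there.\<close>
  have closed: "group_commutator G x y \<in> H" if "x \<in> H" "y \<in> H" for x y
    using that by (simp add: group_commutator_def)
  have "foldl (group_commutator (G\<lparr>carrier := H\<rparr>)) d ys = foldl (group_commutator G) d ys"
    if "d \<in> H" "set ys \<subseteq> H" for d ys
    using that by (induction ys arbitrary: d) (simp_all add: * closed)
  then show ?thesis
    using assms by (cases xs) simp_all
qed

section \<open>Summing over tuples of cosets\<close>

text \<open>A tuple with trivial commutator lies in the product of its own cosets, whose commutator
  is the identity \<open>H\<close> of the quotient. Each such product contributes at most the count
  for \<open>H\<close>, a bound independent of the cosets.\<close>

lemma card_trivial_simple_commutator_le:
  assumes fin: "finite (carrier G)"
  shows "card {xs. length xs = k + 1 \<and> set xs \<subseteq> carrier G \<and> simple_commutator G xs = \<one>}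
       \<le> card {Cs. length Cs = k + 1 \<and> set Cs \<subseteq> rcosets H \<and> simple_commutator (G Mod H) Cs = H}
       * card {xs. length xs = k + 1 \<and> set xs \<subseteq> H \<and> simple_commutator G xs = \<one>}"
    (is "card ?S \<le> card ?T * card ?U")
proof -
  let ?F = "\<lambda>Cs. {xs. list_all2 (\<in>) xs Cs \<and> simple_commutator G xs = \<one>}"
  have "finite (rcosets H)"
    using fin by (simp add: RCOSETS_def)
  then have finT: "finite ?T"
    using finite_lists_length_eq[of "rcosets H" "k + 1"] by (rule_tac finite_subset) auto
  have finH: "finite H"
    using fin finite_subset subset by blast
  have finF: "finite (?F Cs)" if "Cs \<in> ?T" for Cs
  proof -
    have "finite C" if "C \<in> set Cs" for C
      using that \<open>Cs \<in> ?T\<close> rcosets_finite[OF _ subset finH] by auto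
    then show ?thesis
      using finite_list_all2_mem[of Cs] by (rule_tac finite_subset) auto
  qed
  have "?S \<subseteq> (\<Union>Cs\<in>?T. ?F Cs)"
  proof
    fix xs assume xs: "xs \<in> ?S"
    then have "map ((#>) H) xs \<in> ?T"
      using simple_commutator_FactGroup[of xs] by (auto simp: RCOSETS_def coset_mult_one subset)
    moreover have "list_all2 (\<in>) xs (map ((#>) H) xs)"
      using xs rcos_self[OF _ subgroup_axioms] unfolding list_all2_map2
      by (intro list.rel_refl_strong) auto
    ultimately show "xs \<in> (\<Union>Cs\<in>?T. ?F Cs)"
      using xs by blast
  qed
  then have "card ?S \<le> card (\<Union>Cs\<in>?T. ?F Cs)"
    using finT finF by (intro card_mono) auto
  also have "\<dots> \<le> (\<Sum>Cs\<in>?T. card (?F Cs))"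
    using finT by (rule card_UN_le)
  also have "\<dots> \<le> (\<Sum>Cs\<in>?T. card ?U)"
    using card_simple_commutator_le[OF fin] by (intro sum_mono) auto
  finally show ?thesis
    by simp
qed

end

theorem theorem1p21:
  fixes G (structure) and N :: "'a set" and k :: nat
  assumes "group G"
    and "finite (carrier G)"
    and "N \<lhd> G"
  shows "dc k G \<le> dc k (G\<lparr>carrier := N\<rparr>) * dc k (G Mod N)"
proof -
  interpret normal N G
    by fact
  let ?S = "{xs. length xs = k + 1 \<and> set xs \<subseteq> carrier G \<and> simple_commutator G xs = \<one>}"
  let ?T = "{Cs. length Cs = k + 1 \<and> set Cs \<subseteq> rcosets N \<and> simple_commutator (G Mod N) Cs = N}"
  let ?U = "{xs. length xs = k + 1 \<and> set xs \<subseteq> N \<and> simple_commutator G xs = \<one>}"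
  \<comment> \<open>Lagrange's theorem splits the denominator, the (k+1)-st power of the order, into
    those of the two factors.\<close>
  have ord: "order G = card N * card (rcosets N)"
    using lagrange[OF subgroup_axioms] by (simp add: mult.commute)
  have "?U = {xs. length xs = k + 1 \<and> set xs \<subseteq> N \<and> simple_commutator (G\<lparr>carrier := N\<rparr>) xs = \<one>}"
    using simple_commutator_subgroup by auto
  then have U: "dc k (G\<lparr>carrier := N\<rparr>) = card ?U / card N ^ (k + 1)"
    by (simp add: dc_def order_def)
  have T: "dc k (G Mod N) = card ?T / card (rcosets N) ^ (k + 1)"
    by (simp add: dc_def order_def FactGroup_def)
  have "real (card ?S) \<le> real (card ?T * card ?U)"
    using card_trivial_simple_commutator_le[OF assms(2)] by (simp only: of_nat_le_iff)
  then have "dc k G \<le> real (card ?T * card ?U) / real (order G) ^ (k + 1)"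
    unfolding dc_def by (intro divide_right_mono) auto
  also have "\<dots> = dc k (G\<lparr>carrier := N\<rparr>) * dc k (G Mod N)"
    by (simp add: U T ord power_mult_distrib mult_ac)
  finally show ?thesis .
qed

end
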